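(* For every integer $r\ge 0$, \[ \sum_{n=1}^\infty \frac{1}{(2n+1)(2n+2r+1)}\frac{\binom{4n}{2n}}{\binom{2n+2r}{n+r}}\frac{1}{2^{2n}}=\frac{1}{2^{2r-1}}\int_0^{\pi/2}\sin^{2r}x\,\sin(x/2)\,dx-\frac{1}{(2r+1)\binom{2r}{r}}. \] *)

theory Defs
  imports "HOL-Analysis.Analysis"
begin

end

(* For 0 <= x < pi/2, sin (x/2) is half the difference of sqrt (1 + sin x) and sqrt (1 - sin x),
   that is, the odd part of the binomial series of sqrt (1 + y) at y = sin x.  The theorem follows
   by multiplying this series with sin x ^ (2 r) and integrating termwise, using Wallis' formula
   for the odd powers of sin; the constant subtracted is the term n = 0.  All terms are
   nonnegative, so the partial sums are dominated by their limit. *)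
theory Submission
  imports Defs
begin

lemma central_binomial_Suc:
  "real ((2 * Suc m) choose Suc m) = 2 * (2 * real m + 1) * real ((2 * m) choose m) / (real m + 1)"
proof -
  have central: "real ((2 * k) choose k) = fact (2 * k) / (fact k * fact k)" for k
    using binomial_fact[of k "2 * k", where 'a = real] by simp
  have facts: "fact (2 * Suc m) = (2 * real m + 2) * (2 * real m + 1) * fact (2 * m)"
    "fact (Suc m) = (real m + 1) * (fact m :: real)"
    by (simp_all add: algebra_simps)
  show ?thesis
    unfolding central facts by (simp add: divide_simps) (simp add: algebra_simps)
qed

text \<open>By induction: passing from \<open>m\<close> to \<open>Suc m\<close> multiplies both
  sides by -(2m + 1) / (2(m + 2)). The sign is positive for even \<open>m\<close>, so sqrt (1 + y)
  has positive coefficients at the odd powers of y.\<close>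

lemma gbinomial_half_Suc:
  "((1/2 :: real) gchoose Suc m) = (-1) ^ m * real ((2 * m) choose m) / (2 * (real m + 1) * 4 ^ m)"
proof (induction m)
  case 0
  show ?case by simp
next
  case (Suc m)
  have "((1/2 :: real) gchoose Suc (Suc m)) = (1/2 gchoose Suc m) * (1/2 - real (Suc m)) / real (Suc (Suc m))"
    using gbinomial_mult_1[of "1/2 :: real" "Suc m"] by (simp add: field_simps)
  then show ?case
    unfolding Suc.IH central_binomial_Suc by (simp add: divide_simps) (simp add: algebra_simps)
qed

text \<open>Subtracting the binomial series at -y from the one at y cancels the even powers and
  doubles the odd ones.\<close>

lemma sqrt_odd_part_sums:
  fixes y :: real
  assumes "\<bar>y\<bar> < 1"
  shows "(\<lambda>n. (1/2 gchoose (2 * n + 1)) * y ^ (2 * n + 1)) sums ((sqrt (1 + y) - sqrt (1 - y)) / 2)"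
proof -
  have "(\<lambda>n. ((1/2 gchoose n) * y ^ n - (1/2 gchoose n) * (-y) ^ n) / 2)
      sums (((1 + y) powr (1/2) - (1 + -y) powr (1/2)) / 2)"
    using assms by (intro sums_divide sums_diff gen_binomial_real) auto
  then have "(\<lambda>n. ((1/2 gchoose n) * y ^ n - (1/2 gchoose n) * (-y) ^ n) / 2)
      sums ((sqrt (1 + y) - sqrt (1 - y)) / 2)"
    using assms by (simp add: powr_half_sqrt)
  moreover have "((1/2 gchoose n) * y ^ n - (1/2 gchoose n) * (-y) ^ n) / 2
      = (if even n then 0 else (1/2 gchoose n) * y ^ n)" for n
    by simp
  ultimately have sums: "(\<lambda>n. if even n then 0 else (1/2 gchoose n) * y ^ n)
      sums ((sqrt (1 + y) - sqrt (1 - y)) / 2)"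
    by simp
  \<comment> \<open>The vanishing even terms are dropped by reindexing along the odd
    numbers.\<close>
  have "strict_mono (\<lambda>n::nat. 2 * n + 1)"
    by (simp add: strict_mono_def)
  moreover have "(if even n then 0 else (1/2 gchoose n) * y ^ n) = 0"
    if "n \<notin> range (\<lambda>n::nat. 2 * n + 1)" for n :: nat
    using that by (auto elim!: oddE)
  ultimately show ?thesis
    using sums sums_mono_reindex[of "\<lambda>n. 2 * n + 1" "\<lambda>n. if even n then 0 else (1/2 gchoose n) * y ^ n"]
    by simp
qed

text \<open>Both radicands are squares, of cos (x/2) + sin (x/2) and cos (x/2) - sin (x/2). On this
  range 0 \<le> sin (x/2) \<le> cos (x/2), so the roots come out without absolute values.\<close>

lemma sin_half_eq_sqrt:
  assumes "0 \<le> x" "x \<le> pi / 2"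
  shows "sin (x / 2) = (sqrt (1 + sin x) - sqrt (1 - sin x)) / 2"
proof -
  have sin: "sin x = 2 * sin (x / 2) * cos (x / 2)"
    using sin_double[of "x / 2"] by simp
  have "cos (x / 2) = sin (pi / 2 - x / 2)"
    by (simp add: sin_diff)
  then have le: "sin (x / 2) \<le> cos (x / 2)"
    using assms by (simp add: sin_mono_le_eq)
  have nonneg: "0 \<le> sin (x / 2)"
    using assms by (intro sin_ge_zero) auto
  have "1 + sin x = (cos (x / 2) + sin (x / 2))\<^sup>2" "1 - sin x = (cos (x / 2) - sin (x / 2))\<^sup>2"
    using sin_cos_squared_add[of "x / 2"] by (auto simp: sin power2_sum power2_diff)
  then show ?thesis
    using le nonneg by simp
qed

text \<open>Wallis' recurrence: cos x sin^(2N+2) x vanishes at both endpoints, so the integral of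
  its derivative is 0. With I(N) denoting the integral, this reads (2N + 3) I(N+1) = (2N + 2)
  I(N).\<close>

lemma has_integral_sin_odd_power:
  "((\<lambda>x. sin x ^ (2 * N + 1)) has_integral 4 ^ N / ((2 * real N + 1) * real ((2 * N) choose N))) {0..pi / 2}"
proof (induction N)
  case 0
  have "((\<lambda>x. sin x) has_integral (- cos (pi / 2) - (- cos 0))) {0..pi / 2}"
    by (intro fundamental_theorem_of_calculus)
      (auto intro!: derivative_eq_intros simp flip: has_real_derivative_iff_has_vector_derivative)
  then show ?case by simp
next
  case (Suc N)
  let ?I = "4 ^ N / ((2 * real N + 1) * real ((2 * N) choose N))"
  have "((\<lambda>x. (2 * real N + 2) * sin x ^ (2 * N + 1) - (2 * real N + 3) * sin x ^ (2 * Suc N + 1))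
      has_integral (cos (pi / 2) * sin (pi / 2) ^ (2 * N + 2) - cos 0 * sin 0 ^ (2 * N + 2))) {0..pi / 2}"
  proof (rule fundamental_theorem_of_calculus)
    fix x :: real
    have "((\<lambda>x. cos x * sin x ^ (2 * N + 2)) has_real_derivative
        sin x ^ (2 * N + 1) * ((2 * real N + 2) * (cos x)\<^sup>2 - (sin x)\<^sup>2)) (at x within {0..pi / 2})"
      by (rule derivative_eq_intros refl)+ (simp add: algebra_simps power2_eq_square)
    also have "sin x ^ (2 * N + 1) * ((2 * real N + 2) * (cos x)\<^sup>2 - (sin x)\<^sup>2)
        = (2 * real N + 2) * sin x ^ (2 * N + 1) - (2 * real N + 3) * sin x ^ (2 * Suc N + 1)"
      unfolding cos_squared_eq by (simp add: algebra_simps power2_eq_square)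
    finally show "((\<lambda>x. cos x * sin x ^ (2 * N + 2)) has_vector_derivative
        (2 * real N + 2) * sin x ^ (2 * N + 1) - (2 * real N + 3) * sin x ^ (2 * Suc N + 1))
        (at x within {0..pi / 2})"
      by (simp add: has_real_derivative_iff_has_vector_derivative)
  qed simp
  \<comment> \<open>Subtracting the zero integral from the scaled induction hypothesis isolates the
    next odd power.\<close>
  from has_integral_diff[OF has_integral_mult_right[OF Suc.IH, of "2 * real N + 2"] this]
  have "((\<lambda>x. (2 * real N + 3) * sin x ^ (2 * Suc N + 1)) has_integral (2 * real N + 2) * ?I) {0..pi / 2}"
    by simp
  from has_integral_mult_right[OF this, of "1 / (2 * real N + 3)"]
  have "((\<lambda>x. sin x ^ (2 * Suc N + 1)) has_integral (2 * real N + 2) * ?I / (2 * real N + 3)) {0..pi / 2}"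
    by (simp add: add_nonneg_eq_0_iff ac_simps)
  moreover have "(2 * real N + 2) * ?I / (2 * real N + 3)
      = 4 ^ Suc N / ((2 * real (Suc N) + 1) * real ((2 * Suc N) choose Suc N))"
    unfolding central_binomial_Suc by (simp add: divide_simps) (simp add: algebra_simps)
  ultimately show ?case by (simp only:)
qed

text \<open>By nonnegativity every partial sum lies between 0 and \<open>g\<close>, so
  \<open>g\<close> itself is the dominating function. Convergence is asked only in the open
  interval, since the endpoints do not affect the integrals.\<close>

lemma sums_integral_dominated:
  fixes f :: "nat \<Rightarrow> real \<Rightarrow> real"
  assumes f: "\<And>n. f n integrable_on {a..b}" and g: "g integrable_on {a..b}"
    and nonneg: "\<And>n x. x \<in> {a<..<b} \<Longrightarrow> 0 \<le> f n x"
    and sums: "\<And>x. x \<in> {a<..<b} \<Longrightarrow> (\<lambda>n. f n x) sums g x"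
  shows "(\<lambda>n. integral {a..b} (f n)) sums integral {a..b} g"
proof -
  have "(\<lambda>m. integral {a<..<b} (\<lambda>x. \<Sum>n<m. f n x)) \<longlonglongrightarrow> integral {a<..<b} g"
  proof (rule dominated_convergence(2))
    show "(\<lambda>x. \<Sum>n<m. f n x) integrable_on {a<..<b}" for m
      using f by (intro integrable_sum) (auto simp: integrable_on_open_interval_real)
    show "g integrable_on {a<..<b}"
      using g by (simp add: integrable_on_open_interval_real)
    show "norm (\<Sum>n<m. f n x) \<le> g x" if "x \<in> {a<..<b}" for m x
      using sum_le_suminf[OF sums_summable[OF sums[OF that]], of "{..<m}"] nonneg[OF that]
        sums_unique[OF sums[OF that]] by (simp add: sum_nonneg)
    show "(\<lambda>m. \<Sum>n<m. f n x) \<longlonglongrightarrow> g x" if "x \<in> {a<..<b}" for x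
      using sums[OF that] by (simp add: sums_def)
  qed
  moreover have "integral {a<..<b} (\<lambda>x. \<Sum>n<m. f n x) = (\<Sum>n<m. integral {a..b} (f n))" for m
    using f by (simp add: integral_open_interval_real[symmetric] integral_sum)
  ultimately show ?thesis
    by (simp add: sums_def integral_open_interval_real)
qed

theorem theorem10:
  fixes r :: nat
  shows "(\<lambda>k. let n = Suc k in
            1 / ((2 * real n + 1) * (2 * real n + 2 * real r + 1))
            * (real ((4 * n) choose (2 * n)) / real ((2 * n + 2 * r) choose (n + r)))
            * (1 / 2 ^ (2 * n)))
         sums
         (1 / (2 powi (2 * int r - 1))
            * integral {0..pi / 2} (\<lambda>x::real. sin x ^ (2 * r) * sin (x / 2))
          - 1 / ((2 * real r + 1) * real ((2 * r) choose r)))"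
proof -
  define t where "t n = 1 / ((2 * real n + 1) * (2 * real n + 2 * real r + 1))
      * (real ((4 * n) choose (2 * n)) / real ((2 * n + 2 * r) choose (n + r))) * (1 / 2 ^ (2 * n))" for n
  define c where "c n = (1/2 gchoose (2 * n + 1) :: real)" for n
  define f where "f n x = c n * sin x ^ (2 * (n + r) + 1)" for n and x :: real
  \<comment> \<open>The lower index is the successor of the even number 2n, so the sign disappears
    and 4 ^ (2n) becomes 16 ^ n.\<close>
  have c: "c n = real ((4 * n) choose (2 * n)) / (2 * (2 * real n + 1) * 16 ^ n)" for n
    using gbinomial_half_Suc[of "2 * n"] by (simp add: c_def power_mult)
  have f: "(f n has_integral c n * (4 ^ (n + r) / ((2 * real (n + r) + 1) * real ((2 * (n + r)) choose (n + r)))))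
      {0..pi / 2}" for n
    unfolding f_def by (intro has_integral_mult_right has_integral_sin_odd_power)
  have "(\<lambda>n. integral {0..pi / 2} (f n)) sums integral {0..pi / 2} (\<lambda>x. sin x ^ (2 * r) * sin (x / 2))"
  proof (rule sums_integral_dominated)
    show "f n integrable_on {0..pi / 2}" for n
      using f by (auto simp: integrable_on_def)
    show "(\<lambda>x. sin x ^ (2 * r) * sin (x / 2)) integrable_on {0..pi / 2}"
      by (intro integrable_continuous_interval continuous_intros) auto
    fix x :: real
    assume x: "x \<in> {0<..<pi / 2}"
    then have pos: "0 < sin x"
      by (intro sin_gt_zero) auto
    then show "0 \<le> f n x" for n
      by (simp add: f_def c)
    \<comment> \<open>Strictness keeps sin x inside the open disc of convergence; this is where x =
      pi/2 is excluded.\<close>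
    have "sin x < 1"
      using x sin_monotone_2pi[of x "pi / 2"] by simp
    with pos have "(\<lambda>n. c n * sin x ^ (2 * n + 1)) sums sin (x / 2)"
      using x sqrt_odd_part_sums[of "sin x"] by (simp add: sin_half_eq_sqrt c_def)
    from sums_mult[OF this, of "sin x ^ (2 * r)"]
    show "(\<lambda>n. f n x) sums (sin x ^ (2 * r) * sin (x / 2))"
      by (simp add: f_def power_add algebra_simps)
  qed
  \<comment> \<open>The prefactor 1 / 2^(2r-1), written as 2 / 4^r, turns the n-th integral into
    exactly \<open>t n\<close>.\<close>
  then have "(\<lambda>n. 2 / 4 ^ r * integral {0..pi / 2} (f n))
      sums (2 / 4 ^ r * integral {0..pi / 2} (\<lambda>x. sin x ^ (2 * r) * sin (x / 2)))"
    by (rule sums_mult)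
  moreover have "2 / 4 ^ r * integral {0..pi / 2} (f n) = t n" for n
  proof -
    have powers: "(16 :: real) ^ n = 4 ^ n * 4 ^ n" "(2 :: real) ^ (2 * n) = 4 ^ n"
      "(4 :: real) ^ (n + r) = 4 ^ n * 4 ^ r"
      by (simp_all add: power_mult power_add flip: power_mult_distrib)
    \<comment> \<open>Here F stands for 4^n and R for 4^r; A and B are the linear factors, C and D
      the binomials, kept opaque during the cancellation.\<close>
    have cancel: "2 / R * (C / (2 * A * (F * F)) * (F * R / (B * D))) = 1 / (A * B) * (C / D) * (1 / F)"
      if "R \<noteq> 0" "F \<noteq> 0" for A B C D F R :: real
      using that by simp
    have index: "2 * real (n + r) + 1 = 2 * real n + 2 * real r + 1" "2 * (n + r) = 2 * n + 2 * r"
      by simp_all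
    show ?thesis
      unfolding integral_unique[OF f] c t_def powers index by (rule cancel) simp_all
  qed
  \<comment> \<open>The exponent is -1 at r = 0, hence the integer power.\<close>
  moreover have "1 / (2 powi (2 * int r - 1)) = (2 / 4 ^ r :: real)"
  proof -
    have "(2 :: real) powi (2 * int r) = 4 ^ r"
      by (simp add: power_int_mult)
    then show ?thesis
      by (simp add: power_int_diff)
  qed
  \<comment> \<open>The series obtained starts at n = 0, the claimed one at n = 1; this term is the
    difference.\<close>
  moreover have "t 0 = 1 / ((2 * real r + 1) * real ((2 * r) choose r))"
    by (simp add: t_def)
  ultimately have "(\<lambda>k. t (Suc k)) sums (1 / (2 powi (2 * int r - 1))
        * integral {0..pi / 2} (\<lambda>x. sin x ^ (2 * r) * sin (x / 2))
      - 1 / ((2 * real r + 1) * real ((2 * r) choose r)))"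
    using sums_Suc_iff[of t] by simp
  then show ?thesis
    by (simp only: t_def Let_def)
qed

end
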